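(* Consider the planar polynomial system $$\dot x=-y+x\,(y^3-3xy^2+2x^2y)(1+x^2+y^2),\qquad \dot y=x+y\,(y^3-3xy^2+2x^2y)(1+x^2+y^2).$$ The origin is a (uniformly isochronous) center of this system, the system is not reversible, and the system commutes with no polynomial system that is not proportional to it (that is, every polynomial system commuting with it is a constant multiple of it). Consequently, it is not true that every center of a uniformly isochronous polynomial system either is reversible or admits a nontrivial polynomial commuting system.
   Context: A singular point of a planar autonomous system is a center if it has a punctured neighbourhood filled with nontrivial periodic orbits. A system of the form $\dot x=-y+xH(x,y)$, $\dot y=x+yH(x,y)$ with $H$ a real polynomial, $H(0,0)=0$, is called uniformly isochronous: its solutions move around the origin with constant angular speed ($\dot\vartheta=1$ in polar coordinates). A system $\dot x=f(x,y)$, $\dot y=g(x,y)$ is reversible if there is a line through the origin such that the system is invariant under reflection in this line combined with time reversal $t\mapsto -t$ (in particular its trajectories are then symmetric with respect to this line). Two systems given by vector fields $X$ and $Y$ on $\mathbb{R}^2$ commute if their Lie bracket vanishes identically, $[X,Y]=(DY)X-(DX)Y=0$. A polynomial commuting system is a commuting system with real polynomial right-hand sides; it is nontrivial if it is not proportional to (not a constant multiple of) the given system. *)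

theory Defs
  imports "HOL-Analysis.Analysis"
begin

type_synonym plane = "real \<times> real"

definition solution_of :: "(plane \<Rightarrow> plane) \<Rightarrow> (real \<Rightarrow> plane) \<Rightarrow> bool" where
  "solution_of X \<gamma> \<longleftrightarrow> (\<forall>t. (\<gamma> has_vector_derivative X (\<gamma> t)) (at t))"

definition nontrivial_periodic_solution :: "(plane \<Rightarrow> plane) \<Rightarrow> (real \<Rightarrow> plane) \<Rightarrow> bool" where
  "nontrivial_periodic_solution X \<gamma> \<longleftrightarrow>
     solution_of X \<gamma> \<and> (\<exists>T>0. \<forall>t. \<gamma> (t + T) = \<gamma> t) \<and> \<not> \<gamma> constant_on UNIV"

definition is_center :: "(plane \<Rightarrow> plane) \<Rightarrow> plane \<Rightarrow> bool" where
  "is_center X p \<longleftrightarrow> X p = 0 \<and>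
     (\<exists>U. open U \<and> p \<in> U \<and>
        (\<forall>q\<in>U - {p}. \<exists>\<gamma>. nontrivial_periodic_solution X \<gamma> \<and>
                             q \<in> range \<gamma> \<and> range \<gamma> \<subseteq> U - {p}))"

definition uniformly_isochronous :: "(plane \<Rightarrow> plane) \<Rightarrow> bool" where
  "uniformly_isochronous X \<longleftrightarrow>
     (\<exists>H :: plane \<Rightarrow> real. real_polynomial_function H \<and> H (0, 0) = 0 \<and>
        X = (\<lambda>(x, y). (- y + x * H (x, y), x + y * H (x, y))))"

definition line_reflection :: "plane \<Rightarrow> plane \<Rightarrow> plane" where
  "line_reflection u p = (2 * (p \<bullet> u) / (u \<bullet> u)) *\<^sub>R u - p"

text \<open>Substituting \<open>q(s) = R (\<gamma> (-s))\<close>, where \<open>R\<close> is the (linear, involutive) reflection in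
  the line spanned by \<open>u\<close>, turns \<open>\<gamma>' = X \<gamma>\<close> into \<open>q' = - R (X (R q))\<close>; invariance of the system
  means that the new right-hand side is again \<open>X\<close>.\<close>

definition reversible :: "(plane \<Rightarrow> plane) \<Rightarrow> bool" where
  "reversible X \<longleftrightarrow>
     (\<exists>u. u \<noteq> 0 \<and> (\<forall>q. - line_reflection u (X (line_reflection u q)) = X q))"

definition lie_bracket :: "(plane \<Rightarrow> plane) \<Rightarrow> (plane \<Rightarrow> plane) \<Rightarrow> plane \<Rightarrow> plane" where
  "lie_bracket X Y p = frechet_derivative Y (at p) (X p) - frechet_derivative X (at p) (Y p)"

definition commuting :: "(plane \<Rightarrow> plane) \<Rightarrow> (plane \<Rightarrow> plane) \<Rightarrow> bool" where
  "commuting X Y \<longleftrightarrow> (\<forall>p. lie_bracket X Y p = 0)"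

definition proportional_to :: "(plane \<Rightarrow> plane) \<Rightarrow> (plane \<Rightarrow> plane) \<Rightarrow> bool" where
  "proportional_to X Y \<longleftrightarrow> (\<exists>c::real. \<forall>p. Y p = c *\<^sub>R X p)"

definition example_field :: "plane \<Rightarrow> plane" where
  "example_field = (\<lambda>(x, y).
     (- y + x * (y^3 - 3 * x * y^2 + 2 * x^2 * y) * (1 + x^2 + y^2),
        x + y * (y^3 - 3 * x * y^2 + 2 * x^2 * y) * (1 + x^2 + y^2)))"

end

theory Submission
  imports Defs "HOL-Complex_Analysis.Conformal_Mappings"
    "HOL-Real_Asymp.Real_Asymp"
begin

text \<open>
  In polar coordinates the system reads \<open>r' = (r^4 + r^6) h(\<theta>)\<close>, \<open>\<theta>' = 1\<close>, where
  \<open>h(\<theta>)\<close> is the cubic form \<open>y (y - x) (y - 2 x)\<close> evaluated on the unit circle.  Everything follows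
  from this form.

  \<^bold>\<open>Centre.\<close>  The equation is separable: \<open>dr / (r^4 + r^6) = h d\<theta>\<close>.  With \<open>\<Phi>\<close> a primitive of the left
  side and \<open>G\<close> one of \<open>h\<close>, the orbits lie on the curves \<open>\<Phi>(r) = G(\<theta>) + c\<close>.  As \<open>\<Phi>\<close> increases from
  \<open>-\<infinity>\<close> through \<open>0\<close> and \<open>G\<close> is a bounded trigonometric polynomial, the equation can be solved for \<open>r\<close>
  whenever \<open>c\<close> is sufficiently negative, and it then defines a closed orbit of period \<open>2 \<pi>\<close>
  (\<open>periodic_orbit\<close>, \<open>center\<close>).

  \<^bold>\<open>No reversibility.\<close>  A reflection that reverses the field changes the sign of the cubic form, so it
  permutes the three lines \<open>y = 0\<close>, \<open>y = x\<close>, \<open>y = 2 x\<close>.  Their consecutive angles are pairwise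
  different, so no reflection does this (\<open>not_reversible\<close>).

  \<^bold>\<open>No commuting field.\<close>  Write a commuting polynomial field as \<open>f e_r + g e_t\<close> in the rotating
  orthonormal frame.  For fixed \<open>\<theta>\<close> both \<open>f\<close> and \<open>g\<close> are polynomials in \<open>r\<close>, and the vanishing of
  the bracket is a pair of linear partial differential equations for them (\<open>commuting_polar\<close>).
  Comparing coefficients of powers of \<open>r\<close> gives two recurrences.  Since \<open>H\<close> is not homogeneous, each
  recurrence links three levels; read at the top degree, it bounds the degrees of \<open>f\<close> and \<open>g\<close>, by \<open>6\<close> and \<open>1\<close>,
  and descending from there all coefficients except those of a multiple of the given field
  vanish (\<open>tangential_coefficients\<close>, \<open>radial_coefficients\<close>).  The last free constant is removed by
  parity: the coefficient of \<open>r^4\<close> in \<open>f\<close> is an odd function under \<open>\<theta> \<mapsto> \<theta> + \<pi>\<close>.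
\<close>

section \<open>The field in polar form\<close>

definition cubic :: "real \<Rightarrow> real \<Rightarrow> real" where
  "cubic x y = y^3 - 3 * x * y^2 + 2 * x^2 * y"

text \<open>The derivative of the cubic form along the rotation field \<open>(- y, x)\<close>.\<close>

definition cubic_angular :: "real \<Rightarrow> real \<Rightarrow> real" where
  "cubic_angular x y = x * (3 * y^2 - 6 * x * y + 2 * x^2) - y * (4 * x * y - 3 * y^2)"

abbreviation h :: "real \<Rightarrow> real" where "h \<theta> \<equiv> cubic (cos \<theta>) (sin \<theta>)"
abbreviation h' :: "real \<Rightarrow> real" where "h' \<theta> \<equiv> cubic_angular (cos \<theta>) (sin \<theta>)"

definition er :: "real \<Rightarrow> plane" where "er \<theta> = (cos \<theta>, sin \<theta>)"
definition et :: "real \<Rightarrow> plane" where "et \<theta> = (- sin \<theta>, cos \<theta>)"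

lemma cubic_factored: "cubic x y = y * (y - x) * (y - 2 * x)"
  unfolding cubic_def by (simp add: algebra_simps power2_eq_square power3_eq_cube)

lemma cubic_scale: "cubic (r * x) (r * y) = r^3 * cubic x y"
  unfolding cubic_def by (simp add: algebra_simps power2_eq_square power3_eq_cube)

lemma h_deriv: "(h has_real_derivative h' \<theta>) (at \<theta>)"
  unfolding cubic_def cubic_angular_def
  by (rule derivative_eq_intros refl | simp)+
     (simp add: algebra_simps power2_eq_square power3_eq_cube)

lemma h_shift_pi: "h (\<theta> + pi) = - h \<theta>"
  unfolding cubic_def by (simp add: algebra_simps)

lemma example_field_cubic:
  "example_field (x, y) =
     (- y + x * (cubic x y * (1 + x^2 + y^2)), x + y * (cubic x y * (1 + x^2 + y^2)))"
  unfolding example_field_def cubic_def by (simp add: algebra_simps)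

lemma er_deriv: "(er has_vector_derivative et t) (at t)"
  unfolding er_def et_def
  by (auto intro!: has_vector_derivative_Pair derivative_eq_intros
      simp: has_real_derivative_iff_has_vector_derivative[symmetric])

lemma et_deriv: "(et has_vector_derivative - er t) (at t)"
  unfolding er_def et_def uminus_Pair
  by (auto intro!: has_vector_derivative_Pair derivative_eq_intros
      simp: has_real_derivative_iff_has_vector_derivative[symmetric])

lemma polar_norm: "(r * cos \<theta>)^2 + (r * sin \<theta>)^2 = (r::real)^2"
  by (simp add: power_mult_distrib sin_squared_eq algebra_simps)

lemma polar_point:
  obtains r \<theta> where "p = r *\<^sub>R er \<theta>" "r \<ge> 0"
proof (cases "p = 0")
  case True
  then show ?thesis using that[of 0 0] by simp
next
  case False
  obtain x y where p: "p = (x, y)" by force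
  define r where "r = sqrt (x^2 + y^2)"
  have r: "r > 0" "r^2 = x^2 + y^2"
    using False p sum_power2_gt_zero_iff[of x y] by (auto simp: r_def zero_prod_def)
  have "(x / r)^2 + (y / r)^2 = r^2 / r^2"
    by (simp only: power_divide add_divide_distrib[symmetric] r(2))
  then have "(x / r)^2 + (y / r)^2 = 1" using r(1) by simp
  then obtain t where "x / r = cos t" "y / r = sin t"
    using sincos_total_2pi by metis
  then show ?thesis using that[of r t] r p by (auto simp: er_def field_simps)
qed

lemma example_field_polar:
  "example_field (r *\<^sub>R er \<theta>) = r *\<^sub>R et \<theta> + ((r^4 + r^6) * h \<theta>) *\<^sub>R er \<theta>"
proof -
  have *: "1 + (r * cos \<theta>)^2 + (r * sin \<theta>)^2 = 1 + r^2" using polar_norm[of r \<theta>] by simp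
  show ?thesis
    unfolding er_def et_def scaleR_Pair real_scaleR_def example_field_cubic cubic_scale *
    by (simp add: algebra_simps eval_nat_numeral)
qed

section \<open>The centre\<close>

text \<open>The primitive of \<open>1 / (r^4 + r^6) = 1 / r^4 - 1 / r^2 + 1 / (1 + r^2)\<close>.\<close>

definition \<Phi> :: "real \<Rightarrow> real" where
  "\<Phi> r = - 1 / (3 * r^3) + 1 / r + arctan r"

text \<open>On the unit circle this is the primitive \<open>- cos \<theta> - cos\<^sup>3 \<theta> / 3 - sin\<^sup>3 \<theta>\<close> of \<open>h\<close>, made
  homogeneous of degree 3 so that it is defined and continuous on the whole plane.\<close>

definition G :: "real \<Rightarrow> real \<Rightarrow> real" where
  "G x y = - (4 * x^3 + 3 * x * y^2 + 3 * y^3) / 3"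

lemma Phi_deriv:
  assumes "r > 0"
  shows "(\<Phi> has_real_derivative inverse (r^4 + r^6)) (at r)"
proof -
  have nz: "1 + r\<^sup>2 \<noteq> 0" using zero_le_power2[of r] by linarith
  have "(\<Phi> has_real_derivative (1 / r^4 - 1 / r^2 + 1 / (1 + r^2))) (at r)"
  proof -
    have "((\<lambda>r. - 1 / (3 * r^3)) has_real_derivative 1 / r^4) (at r)"
      using assms by (auto intro!: derivative_eq_intros simp: field_simps eval_nat_numeral)
    moreover have "((\<lambda>r. 1 / r) has_real_derivative - (1 / r^2)) (at r)"
      using assms by (auto intro!: derivative_eq_intros simp: field_simps eval_nat_numeral)
    ultimately show ?thesis
      using DERIV_add[OF DERIV_add DERIV_arctan] unfolding \<Phi>_def
      by (fastforce simp: inverse_eq_divide)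
  qed
  moreover have "1 / r^4 - 1 / r^2 + 1 / (1 + r^2) = inverse (r^4 + r^6)"
  proof -
    have "1 / r^4 - 1 / r^2 = (1 - r^2) / r^4"
      using assms by (simp add: field_simps eval_nat_numeral)
    then have "1 / r^4 - 1 / r^2 + 1 / (1 + r^2) = ((1 - r^2) * (1 + r^2) + r^4) / (r^4 * (1 + r^2))"
      using assms nz by (simp add: add_frac_eq)
    also have "(1 - r^2) * (1 + r^2) + r^4 = 1" by (simp add: algebra_simps eval_nat_numeral)
    also have "r^4 * (1 + r^2) = r^4 + r^6" by (simp add: algebra_simps eval_nat_numeral)
    finally show ?thesis by (simp add: inverse_eq_divide)
  qed
  ultimately show ?thesis by simp
qed

lemma Phi_strict_mono:
  assumes "0 < r" "r < s"
  shows "\<Phi> r < \<Phi> s"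
proof (rule DERIV_pos_imp_increasing[OF assms(2)])
  fix x assume "r \<le> x" "x \<le> s"
  with assms have "x > 0" by simp
  then show "\<exists>y. (\<Phi> has_real_derivative y) (at x) \<and> y > 0"
    using Phi_deriv by (intro exI[of _ "inverse (x^4 + x^6)"]) (auto intro!: add_pos_pos)
qed

lemma Phi_surj:
  assumes "v < 0"
  shows "\<exists>r>0. \<Phi> r = v"
proof -
  have "filterlim \<Phi> at_bot (at_right 0)" unfolding \<Phi>_def by real_asymp
  then have "\<forall>\<^sub>F r in at_right 0. \<Phi> r < v"
    by (simp add: filterlim_at_bot_dense)
  moreover have "\<forall>\<^sub>F r in at_right (0::real). 0 < r \<and> r < 1"
    by (auto simp: eventually_at_right_field intro!: exI[of _ 1])
  ultimately obtain s where s: "\<Phi> s < v" "0 < s" "s < 1"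
    by (metis (mono_tags, lifting) eventually_conj eventually_happens trivial_limit_at_right_real)
  have "0 < \<Phi> 1" by (simp add: \<Phi>_def add_pos_pos arctan_one)
  then have "\<exists>r\<ge>s. r \<le> 1 \<and> \<Phi> r = v"
    using s assms by (intro IVT) (auto intro!: DERIV_isCont Phi_deriv)
  then show ?thesis using s by (metis less_le_trans)
qed

lemma G_deriv: "((\<lambda>\<theta>. G (cos \<theta>) (sin \<theta>)) has_real_derivative h \<theta>) (at \<theta>)"
proof -
  have "((\<lambda>\<theta>. G (cos \<theta>) (sin \<theta>)) has_real_derivative
     (4 * cos \<theta>^2 * sin \<theta> + sin \<theta> * sin \<theta>^2 - 2 * cos \<theta>^2 * sin \<theta> - 3 * sin \<theta>^2 * cos \<theta>)) (at \<theta>)"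
    unfolding G_def
    by (rule derivative_eq_intros refl | simp)+
       (simp add: field_simps power2_eq_square power3_eq_cube)
  then show ?thesis by (simp add: cubic_def algebra_simps power2_eq_square power3_eq_cube)
qed

lemma G_bound: "\<bar>G (cos \<theta>) (sin \<theta>)\<bar> \<le> 10 / 3"
proof -
  have "sin \<theta>^2 \<le> 1" by (simp add: abs_square_le_1)
  then have "\<bar>cos \<theta>^3\<bar> \<le> 1" "\<bar>sin \<theta>^3\<bar> \<le> 1" "\<bar>cos \<theta> * sin \<theta>^2\<bar> \<le> 1"
    by (auto simp: power_abs abs_mult power_le_one intro!: mult_le_one)
  then show ?thesis unfolding G_def by (simp add: abs_le_iff algebra_simps)
qed

text \<open>The first integral \<open>\<Phi>(r) - G(\<theta>)\<close> is singular at the origin.  Multiplying its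
  difference from the level \<open>- 10 / 3\<close> by \<open>r^3\<close> removes the singularity and keeps the sign, so that
  the neighbourhood filled with closed orbits is visibly open.\<close>

definition inner_gauge :: "plane \<Rightarrow> real" where
  "inner_gauge p = - 1 / 3 + norm p^2 + norm p^3 * arctan (norm p)
     - G (fst p) (snd p) + 10 / 3 * norm p^3"

lemma norm_er [simp]: "norm (er \<theta>) = 1"
  by (simp add: er_def norm_Pair)

lemma er_nonzero [simp]: "er \<theta> \<noteq> 0"
  by (metis norm_er norm_zero zero_neq_one)

lemma inner_gauge_polar:
  assumes "r > 0"
  shows "inner_gauge (r *\<^sub>R er \<theta>) = r^3 * (\<Phi> r - G (cos \<theta>) (sin \<theta>) + 10 / 3)"
proof -
  have 1: "G (r * cos \<theta>) (r * sin \<theta>) = r^3 * G (cos \<theta>) (sin \<theta>)"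
    unfolding G_def by (simp add: field_simps power2_eq_square power3_eq_cube)
  have 2: "r^3 * \<Phi> r = - 1 / 3 + r^2 + r^3 * arctan r"
    using assms unfolding \<Phi>_def by (simp add: field_simps power2_eq_square power3_eq_cube)
  have 3: "norm (r *\<^sub>R er \<theta>) = r" using assms by simp
  show ?thesis unfolding inner_gauge_def 3 using 1 2
    by (simp add: er_def algebra_simps)
qed

lemma open_inner_gauge: "open {p. inner_gauge p < 0}"
  unfolding inner_gauge_def G_def
  by (intro open_Collect_less continuous_intros) auto

lemma periodic_orbit:
  assumes "c < - 10 / 3"
  obtains \<rho> where
    "\<And>t. \<rho> t > 0" "\<And>t. \<Phi> (\<rho> t) = G (cos t) (sin t) + c"
    "nontrivial_periodic_solution example_field (\<lambda>t. \<rho> t *\<^sub>R er t)"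
proof -
  \<comment> \<open>\<open>c + G\<close> is negative by the bound on \<open>G\<close>, so only the inverse of \<open>\<Phi>\<close> on negative values is needed.\<close>
  define \<Psi> where "\<Psi> v = (SOME r. r > 0 \<and> \<Phi> r = v)" for v
  have \<Psi>: "\<Psi> v > 0" "\<Phi> (\<Psi> v) = v" if "v < 0" for v
    using someI_ex[of "\<lambda>r. r > 0 \<and> \<Phi> r = v"] Phi_surj[OF that] by (auto simp: \<Psi>_def)
  have inj: "r = s" if "r > 0" "s > 0" "\<Phi> r = \<Phi> s" for r s
    using Phi_strict_mono[of r s] Phi_strict_mono[of s r] that by linarith
  have \<Psi>\<Phi>: "\<Psi> (\<Phi> r) = r" if "r > 0" for r
  proof -
    have "\<exists>r'. r' > 0 \<and> \<Phi> r' = \<Phi> r" using that by blast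
    from someI_ex[OF this] show ?thesis using inj that by (auto simp: \<Psi>_def)
  qed
  have \<Psi>_deriv: "(\<Psi> has_real_derivative (\<Psi> v^4 + \<Psi> v^6)) (at v)" if v: "v < 0" for v
  proof -
    have pos: "\<Psi> v^4 + \<Psi> v^6 > 0" using \<Psi>[OF v] by (simp add: add_pos_pos)
    have "continuous_on {0<..} \<Phi>"
      by (auto intro!: continuous_at_imp_continuous_on DERIV_isCont Phi_deriv)
    then have "(\<Psi> has_real_derivative inverse (inverse (\<Psi> v^4 + \<Psi> v^6))) (at v)"
      using pos by (intro has_field_derivative_inverse_strong_x[where f = \<Phi> and g = \<Psi> and S = "{0<..}"])
        (auto intro!: Phi_deriv \<Psi> v \<Psi>\<Phi>)
    then show ?thesis by simp
  qed
  define \<rho> where "\<rho> t = \<Psi> (G (cos t) (sin t) + c)" for t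
  have neg: "G (cos t) (sin t) + c < 0" for t using G_bound[of t] assms by linarith
  have \<rho>: "\<rho> t > 0" "\<Phi> (\<rho> t) = G (cos t) (sin t) + c" for t
    using \<Psi>[OF neg] by (auto simp: \<rho>_def)
  have \<rho>_deriv: "(\<rho> has_real_derivative (\<rho> t^4 + \<rho> t^6) * h t) (at t)" for t
  proof -
    have "((\<lambda>t. G (cos t) (sin t) + c) has_real_derivative h t) (at t)"
      using G_deriv by (auto intro!: derivative_eq_intros)
    from DERIV_chain2[OF \<Psi>_deriv[OF neg] this] show ?thesis
      unfolding \<rho>_def .
  qed
  have "((\<lambda>t. \<rho> t *\<^sub>R er t) has_vector_derivative example_field (\<rho> t *\<^sub>R er t)) (at t)" for t
    unfolding example_field_polar
    by (rule has_vector_derivative_scaleR[OF \<rho>_deriv er_deriv])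
  then have sol: "solution_of example_field (\<lambda>t. \<rho> t *\<^sub>R er t)" by (simp add: solution_of_def)
  have per: "\<rho> (t + 2 * pi) *\<^sub>R er (t + 2 * pi) = \<rho> t *\<^sub>R er t" for t
    by (simp add: \<rho>_def er_def)
  have "\<not> (\<lambda>t. \<rho> t *\<^sub>R er t) constant_on UNIV"
  proof
    assume "(\<lambda>t. \<rho> t *\<^sub>R er t) constant_on UNIV"
    then have "\<rho> 0 *\<^sub>R er 0 = \<rho> pi *\<^sub>R er pi" by (auto simp: constant_on_def)
    then have "\<rho> 0 = - \<rho> pi" by (simp add: er_def)
    with \<rho>(1)[of 0] \<rho>(1)[of pi] show False by simp
  qed
  with sol per have "nontrivial_periodic_solution example_field (\<lambda>t. \<rho> t *\<^sub>R er t)"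
    unfolding nontrivial_periodic_solution_def by (auto intro!: exI[of _ "2 * pi"])
  with \<rho> show ?thesis using that by blast
qed

lemma center: "is_center example_field (0, 0)"
  unfolding is_center_def
proof (intro conjI exI[of _ "{p. inner_gauge p < 0}"] ballI)
  show "example_field (0, 0) = 0" by (simp add: example_field_def zero_prod_def)
  show "open {p. inner_gauge p < 0}" by (rule open_inner_gauge)
  show "(0, 0) \<in> {p. inner_gauge p < 0}" by (simp add: inner_gauge_def G_def norm_Pair)
  fix q assume "q \<in> {p. inner_gauge p < 0} - {(0, 0)}"
  then have q: "inner_gauge q < 0" "q \<noteq> 0" by (auto simp: zero_prod_def)
  obtain r \<theta> where p: "q = r *\<^sub>R er \<theta>" "r \<ge> 0" by (rule polar_point)
  with q have r: "r > 0" by (cases "r = 0") auto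
  define c where "c = \<Phi> r - G (cos \<theta>) (sin \<theta>)"
  have "c < - 10 / 3"
    using q(1) r unfolding p(1) inner_gauge_polar[OF r] by (simp add: mult_less_0_iff c_def)
  then obtain \<rho> where \<rho>: "\<And>t. \<rho> t > 0" "\<And>t. \<Phi> (\<rho> t) = G (cos t) (sin t) + c"
    "nontrivial_periodic_solution example_field (\<lambda>t. \<rho> t *\<^sub>R er t)"
    using periodic_orbit by blast
  have "\<rho> \<theta> = r"
    using Phi_strict_mono[of r "\<rho> \<theta>"] Phi_strict_mono[of "\<rho> \<theta>" r] r \<rho>(1)[of \<theta>] \<rho>(2)[of \<theta>]
    by (simp add: c_def) (metis less_irrefl linorder_neqE_linordered_idom)
  then have "q \<in> range (\<lambda>t. \<rho> t *\<^sub>R er t)" using p by (intro range_eqI[of _ _ \<theta>]) simp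
  moreover have "\<rho> t *\<^sub>R er t \<in> {p. inner_gauge p < 0} - {(0, 0)}" for t
  proof -
    have "inner_gauge (\<rho> t *\<^sub>R er t) < 0"
      unfolding inner_gauge_polar[OF \<rho>(1)] \<rho>(2) using \<open>c < - 10 / 3\<close> \<rho>(1)[of t]
      by (simp add: mult_less_0_iff)
    moreover have "\<rho> t *\<^sub>R er t \<noteq> 0" using \<rho>(1)[of t] by simp
    then have "\<rho> t *\<^sub>R er t \<noteq> (0, 0)" unfolding zero_prod_def .
    ultimately show ?thesis by blast
  qed
  ultimately show "\<exists>\<gamma>. nontrivial_periodic_solution example_field \<gamma> \<and> q \<in> range \<gamma> \<and>
      range \<gamma> \<subseteq> {p. inner_gauge p < 0} - {(0, 0)}"
    using \<rho>(3) by (intro exI[of _ "\<lambda>t. \<rho> t *\<^sub>R er t"]) (simp add: image_subset_iff)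
qed

section \<open>Uniform isochronicity and the absence of symmetry axes\<close>

lemma isochronous: "uniformly_isochronous example_field"
  unfolding uniformly_isochronous_def
proof (intro exI conjI)
  let ?H = "\<lambda>p::plane. (snd p^3 - 3 * fst p * snd p^2 + 2 * fst p^2 * snd p) * (1 + fst p^2 + snd p^2)"
  have "real_polynomial_function (fst :: plane \<Rightarrow> real)" "real_polynomial_function (snd :: plane \<Rightarrow> real)"
    by (auto intro: real_polynomial_function.intros(1) bounded_linear_fst bounded_linear_snd)
  then show "real_polynomial_function ?H"
    by (intro real_polynomial_function.intros(2-) real_polynomial_function_power
        real_polynomial_function_diff) auto
  show "?H (0, 0) = 0" by simp
  show "example_field = (\<lambda>(x, y). (- y + x * ?H (x, y), x + y * ?H (x, y)))"
    by (simp add: example_field_def mult.assoc)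
qed

lemma line_reflection_matrix:
  assumes "u \<noteq> 0"
  obtains C S where "C^2 + S^2 = 1"
    "\<And>x y. line_reflection u (x, y) = (C * x + S * y, S * x - C * y)"
proof -
  obtain a b where u: "u = (a, b)" by force
  define n where "n = a^2 + b^2"
  have n: "n > 0" using assms u by (auto simp: n_def sum_power2_gt_zero_iff zero_prod_def)
  define C where "C = (a^2 - b^2) / n"
  define S where "S = 2 * a * b / n"
  have "C^2 + S^2 = ((a^2 - b^2)^2 + (2 * a * b)^2) / n^2"
    by (simp add: C_def S_def power_divide add_divide_distrib)
  also have "(a^2 - b^2)^2 + (2 * a * b)^2 = n^2"
    by (simp add: n_def power2_eq_square algebra_simps)
  finally have "C^2 + S^2 = 1" using n by simp
  moreover have "line_reflection u (x, y) = (C * x + S * y, S * x - C * y)" for x y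
  proof -
    have "2 * (x * a + y * b) / n * a - x = C * x + S * y"
         "2 * (x * a + y * b) / n * b - y = S * x - C * y"
      using n by (auto simp: C_def S_def field_simps) (auto simp: n_def power2_eq_square algebra_simps)
    then show ?thesis
      by (simp add: line_reflection_def u n_def power2_eq_square)
  qed
  ultimately show ?thesis using that by blast
qed

lemma not_reversible: "\<not> reversible example_field"
proof
  assume "reversible example_field"
  then obtain u where u: "u \<noteq> 0"
    "\<And>q. - line_reflection u (example_field (line_reflection u q)) = example_field q"
    unfolding reversible_def by blast
  obtain C S where CS: "C^2 + S^2 = 1"
    and R: "\<And>x y. line_reflection u (x, y) = (C * x + S * y, S * x - C * y)"
    using line_reflection_matrix[OF u(1)] by blast
  \<comment> \<open>A reflection anticommutes with the rotation by a right angle, so the rotational part of the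
    field satisfies the condition and only the radial factor is constrained.\<close>
  have anti: "cubic (C * x + S * y) (S * x - C * y) = - cubic x y" if "x^2 + y^2 > 0" for x y
  proof -
    define X where "X = C * x + S * y"
    define Y where "Y = S * x - C * y"
    define k where "k = cubic X Y * (1 + X^2 + Y^2)"
    define l where "l = cubic x y * (1 + x^2 + y^2)"
    have nn: "X^2 + Y^2 = x^2 + y^2"
    proof -
      have "X^2 + Y^2 = (C^2 + S^2) * (x^2 + y^2)"
        by (simp add: X_def Y_def power2_eq_square algebra_simps)
      then show ?thesis using CS by simp
    qed
    have cx: "C * X + S * Y = x" and cy: "S * X - C * Y = y"
    proof -
      have "C * X + S * Y = (C^2 + S^2) * x" "S * X - C * Y = (C^2 + S^2) * y"
        by (simp_all add: X_def Y_def power2_eq_square algebra_simps)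
      then show "C * X + S * Y = x" "S * X - C * Y = y" using CS by simp_all
    qed
    have "- (C * (- Y + X * k) + S * (X + Y * k)) = - y + x * l"
         "- (S * (- Y + X * k) - C * (X + Y * k)) = x + y * l"
      using u(2)[of "(x, y)"] by (simp_all add: R example_field_cubic X_def Y_def k_def l_def)
    moreover have "C * (- Y + X * k) + S * (X + Y * k) = (C * X + S * Y) * k + (S * X - C * Y)"
         "S * (- Y + X * k) - C * (X + Y * k) = (S * X - C * Y) * k - (C * X + S * Y)"
      by (simp_all add: algebra_simps)
    ultimately have "x * (k + l) = 0" "y * (k + l) = 0"
      unfolding cx cy by (simp_all add: algebra_simps)
    with that have "k + l = 0" by auto
    then have "(cubic X Y + cubic x y) * (1 + x^2 + y^2) = 0"
      using nn by (simp add: k_def l_def algebra_simps)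
    then show ?thesis using that by (simp add: X_def Y_def)
  qed
  \<comment> \<open>The images of points on the three zero lines of the cubic form lie on zero lines again.\<close>
  have 1: "cubic C S = 0" using anti[of 1 0] by (simp add: cubic_factored)
  have 2: "cubic (C + S) (S - C) = 0" using anti[of 1 1] by (simp add: cubic_factored)
  have 3: "cubic (C + 2 * S) (S - 2 * C) = 0" using anti[of 1 2]
    by (simp add: cubic_factored algebra_simps)
  have "S = C"
    using 1 2 CS unfolding cubic_factored by auto
  with 3 CS show False unfolding cubic_factored by auto
qed

section \<open>Commuting polynomial fields\<close>

text \<open>The zeros of \<open>h\<close> are simple.  At such a zero the derivative of \<open>h a = 0\<close> reduces to
  \<open>h' a = 0\<close>, which makes \<open>a\<close> vanish there too.  This allows dividing the recurrences by \<open>h\<close>.\<close>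

lemma h_mult_zero:
  assumes "\<And>\<theta>. (a has_real_derivative a' \<theta>) (at \<theta>)" "\<And>\<theta>. h \<theta> * a \<theta> = 0"
  shows "a \<theta> = 0"
proof (cases "h \<theta> = 0")
  case True
  have "((\<lambda>\<theta>. h \<theta> * a \<theta>) has_real_derivative (h' \<theta> * a \<theta> + a' \<theta> * h \<theta>)) (at \<theta>)"
    by (rule DERIV_mult[OF h_deriv assms(1)])
  moreover have "((\<lambda>\<theta>. h \<theta> * a \<theta>) has_real_derivative 0) (at \<theta>)" unfolding assms(2) by simp
  ultimately have "h' \<theta> * a \<theta> = 0" using True DERIV_unique by fastforce
  moreover have "h' \<theta> \<noteq> 0"
  proof
    assume d: "h' \<theta> = 0"
    have "cos \<theta> = 0"
    proof -
      consider "sin \<theta> = 0" | "sin \<theta> = cos \<theta>" | "sin \<theta> = 2 * cos \<theta>"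
        using True by (auto simp: cubic_factored)
      then show ?thesis
        by cases (use d in \<open>auto simp: cubic_angular_def algebra_simps power2_eq_square\<close>)
    qed
    with True show False using sin_cos_squared_add[of \<theta>] by (auto simp: cubic_factored)
  qed
  ultimately show ?thesis by simp
next
  case False
  then show ?thesis using assms(2)[of \<theta>] by simp
qed

text \<open>Polynomials in \<open>r\<close> depending differentiably on the angle, with coefficientwise
  derivative \<open>p'\<close>.  The degree is bounded uniformly in the angle, so that differentiating the
  coefficients differentiates the polynomial function and descending inductions have a start.\<close>

definition poly_family :: "(real \<Rightarrow> real poly) \<Rightarrow> (real \<Rightarrow> real poly) \<Rightarrow> bool" where
  "poly_family p p' \<longleftrightarrow> (\<exists>n. \<forall>\<theta>. degree (p \<theta>) \<le> n) \<and>
     (\<forall>k \<theta>. ((\<lambda>\<theta>. coeff (p \<theta>) k) has_real_derivative coeff (p' \<theta>) k) (at \<theta>))"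

lemma poly_family_add:
  assumes "poly_family p p'" "poly_family q q'"
  shows "poly_family (\<lambda>\<theta>. p \<theta> + q \<theta>) (\<lambda>\<theta>. p' \<theta> + q' \<theta>)"
proof -
  obtain m n where "\<And>\<theta>. degree (p \<theta>) \<le> m" "\<And>\<theta>. degree (q \<theta>) \<le> n"
    using assms unfolding poly_family_def by blast
  then have "degree (p \<theta> + q \<theta>) \<le> max m n" for \<theta>
    by (meson degree_add_le max.coboundedI1 max.coboundedI2)
  then show ?thesis
    using assms unfolding poly_family_def by (auto intro!: derivative_eq_intros)
qed

lemma poly_family_mult:
  assumes "poly_family p p'" "poly_family q q'"
  shows "poly_family (\<lambda>\<theta>. p \<theta> * q \<theta>) (\<lambda>\<theta>. p' \<theta> * q \<theta> + p \<theta> * q' \<theta>)"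
proof -
  obtain m n where "\<And>\<theta>. degree (p \<theta>) \<le> m" "\<And>\<theta>. degree (q \<theta>) \<le> n"
    using assms unfolding poly_family_def by blast
  then have "degree (p \<theta> * q \<theta>) \<le> m + n" for \<theta>
    by (meson degree_mult_le add_mono order_trans)
  moreover have "((\<lambda>\<theta>. coeff (p \<theta> * q \<theta>) k) has_real_derivative
      coeff (p' \<theta> * q \<theta> + p \<theta> * q' \<theta>) k) (at \<theta>)" for k \<theta>
  proof -
    have "((\<lambda>\<theta>. coeff (p \<theta>) i * coeff (q \<theta>) j) has_real_derivative
       coeff (p' \<theta>) i * coeff (q \<theta>) j + coeff (p \<theta>) i * coeff (q' \<theta>) j) (at \<theta>)" for i j
      using assms unfolding poly_family_def by (auto intro!: derivative_eq_intros)
    then show ?thesis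
      unfolding coeff_mult coeff_add sum.distrib[symmetric] by (intro DERIV_sum)
  qed
  ultimately show ?thesis unfolding poly_family_def by blast
qed

lemma poly_family_const:
  assumes "\<And>\<theta>. (a has_real_derivative a' \<theta>) (at \<theta>)"
  shows "poly_family (\<lambda>\<theta>. [:a \<theta>:]) (\<lambda>\<theta>. [:a' \<theta>:])"
  unfolding poly_family_def using assms
  by (auto simp: coeff_pCons split: nat.split intro!: exI[of _ 0])

lemma poly_family_const_X: "poly_family (\<lambda>\<theta>. [:0, 1:]) (\<lambda>\<theta>. 0)"
  unfolding poly_family_def by auto

lemma poly_family_deriv:
  assumes "poly_family p p'"
  shows "((\<lambda>\<theta>. poly (p \<theta>) r) has_real_derivative poly (p' \<theta>) r) (at \<theta>)"
proof -
  obtain n where n: "\<And>\<theta>. degree (p \<theta>) \<le> n" using assms unfolding poly_family_def by blast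
  have d: "((\<lambda>\<theta>. coeff (p \<theta>) k) has_real_derivative coeff (p' \<theta>) k) (at \<theta>)" for k \<theta>
    using assms unfolding poly_family_def by blast
  have "coeff (p' \<theta>) k = 0" if "k > n" for k \<theta>
  proof -
    have "(\<lambda>\<theta>. coeff (p \<theta>) k) = (\<lambda>\<theta>. 0)"
      using n that by (intro ext coeff_eq_0) (meson le_less_trans)
    then show ?thesis using d[of k \<theta>] DERIV_unique[OF _ DERIV_const] by metis
  qed
  then have n': "degree (p' \<theta>) \<le> n" for \<theta> by (intro degree_le) auto
  have ex: "poly q r = (\<Sum>k\<le>n. coeff q k * r ^ k)" if "degree q \<le> n" for q
    unfolding poly_altdef using that
    by (intro sum.mono_neutral_left) (auto simp: coeff_eq_0)
  show ?thesis
    unfolding ex[OF n] ex[OF n'] by (intro DERIV_sum DERIV_cmult_right d)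
qed

text \<open>A linear function has the value \<open>r f(e_r(\<theta>))\<close> at a point in polar form, and sums and
  products preserve polynomial dependence on \<open>r\<close>.\<close>

lemma real_polynomial_function_polar:
  fixes N :: "plane \<Rightarrow> real"
  assumes "real_polynomial_function N"
  shows "\<exists>p p'. poly_family p p' \<and> (\<forall>r \<theta>. N (r *\<^sub>R er \<theta>) = poly (p \<theta>) r)"
  using assms
proof induction
  case (linear f)
  interpret bounded_linear f by fact
  have d: "((\<lambda>\<theta>. f (er \<theta>)) has_real_derivative f (et \<theta>)) (at \<theta>)" for \<theta>
  proof -
    have e: "f (a, b) = a * f (1, 0) + b * f (0, 1)" for a b
    proof -
      have "(a, b) = a *\<^sub>R (1, 0) + b *\<^sub>R (0, 1 :: real)" by simp
      then show ?thesis by (metis add scaleR real_scaleR_def)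
    qed
    show ?thesis unfolding er_def et_def e[of "cos _"] e[of "- sin _"]
      by (auto intro!: derivative_eq_intros)
  qed
  from poly_family_mult[OF poly_family_const_X poly_family_const[OF d]]
  show ?case by (force simp: scaleR)
next
  case (const c)
  show ?case using poly_family_const[of "\<lambda>_. c" "\<lambda>_. 0"] by force
next
  case (add f g)
  then obtain p p' q q' where "poly_family p p'" "poly_family q q'"
    "\<And>r \<theta>. f (r *\<^sub>R er \<theta>) = poly (p \<theta>) r" "\<And>r \<theta>. g (r *\<^sub>R er \<theta>) = poly (q \<theta>) r" by blast
  then show ?case
    by (intro exI[of _ "\<lambda>\<theta>. p \<theta> + q \<theta>"] exI[of _ "\<lambda>\<theta>. p' \<theta> + q' \<theta>"]) (auto intro: poly_family_add)
next
  case (mult f g)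
  then obtain p p' q q' where "poly_family p p'" "poly_family q q'"
    "\<And>r \<theta>. f (r *\<^sub>R er \<theta>) = poly (p \<theta>) r" "\<And>r \<theta>. g (r *\<^sub>R er \<theta>) = poly (q \<theta>) r" by blast
  then show ?case
    by (intro exI[of _ "\<lambda>\<theta>. p \<theta> * q \<theta>"] exI[of _ "\<lambda>\<theta>. p' \<theta> * q \<theta> + p \<theta> * q' \<theta>"])
      (auto intro: poly_family_mult)
qed

text \<open>Downward induction: a fact about the leading coefficient becomes a degree bound.\<close>

lemma zero_above:
  fixes a :: "nat \<Rightarrow> real \<Rightarrow> real"
  assumes "\<And>k \<theta>. k > n \<Longrightarrow> a k \<theta> = 0"
    and step: "\<And>k \<theta>. k \<ge> m \<Longrightarrow> (\<And>j \<theta>. j > k \<Longrightarrow> a j \<theta> = 0) \<Longrightarrow> a k \<theta> = 0"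
    and "k \<ge> m"
  shows "a k \<theta> = 0"
  using \<open>k \<ge> m\<close>
proof (induction "n - k" arbitrary: k \<theta> rule: less_induct)
  case less
  show ?case
  proof (rule step[OF less.prems])
    fix j \<theta> assume "j > k"
    then show "a j \<theta> = 0"
      using less assms(1) by (cases "j > n") auto
  qed
qed

text \<open>For a sequence with last index \<open>k\<close>, the recurrence at \<open>k + 5\<close> leaves only
  \<open>(k - 1) h b_k = 0\<close>.  This excludes every last index above 1; the index 1, where the factor
  vanishes, is the angular speed of a multiple of the given field.\<close>

lemma tangential_coefficients:
  fixes b b' :: "nat \<Rightarrow> real \<Rightarrow> real"
  assumes d: "\<And>k \<theta>. (b k has_real_derivative b' k \<theta>) (at \<theta>)"
    and fin: "\<And>k \<theta>. k > n \<Longrightarrow> b k \<theta> = 0"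
    and rec: "\<And>k \<theta>. b' (k + 5) \<theta> + h \<theta> * ((real k + 1) * b (k + 2) \<theta> + (real k - 1) * b k \<theta>) = 0"
    and rec3: "\<And>\<theta>. b' 3 \<theta> - h \<theta> * b 0 \<theta> = 0"
    and rec1: "\<And>\<theta>. b' 1 \<theta> = 0"
  shows "\<exists>\<beta>. \<forall>k \<theta>. b k \<theta> = (if k = 1 then \<beta> else 0)"
proof -
  have b'0: "b' k \<theta> = 0" if "\<And>\<theta>. b k \<theta> = 0" for k \<theta>
  proof -
    have "b k = (\<lambda>_. 0)" using that by auto
    then show ?thesis using d[of k \<theta>] DERIV_unique[OF _ DERIV_const] by metis
  qed
  have hi: "b k \<theta> = 0" if "k \<ge> 2" for k \<theta>
  proof (rule zero_above[OF fin _ that])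
    fix k \<theta> assume k: "k \<ge> (2::nat)" and z: "\<And>j \<theta>. j > k \<Longrightarrow> b j \<theta> = 0"
    have "h \<theta> * b k \<theta> = 0" for \<theta>
      using rec[of k \<theta>] k by (simp add: z b'0)
    then show "b k \<theta> = 0" by (rule h_mult_zero[OF d])
  qed
  have "b 0 \<theta> = 0" for \<theta>
    using rec3 by (intro h_mult_zero[OF d]) (simp add: b'0 hi)
  moreover have "b 1 \<theta> = b 1 0" for \<theta>
    using d[of 1] rec1 by (metis DERIV_isconst_all)
  ultimately show ?thesis
    using hi by (intro exI[of _ "b 1 0"]) (metis One_nat_def less_2_cases not_le)
qed

text \<open>The leading term \<open>(k - 6) h a_k\<close> of the recurrence excludes degrees above 6.  At degree 6
  the coefficient is free, but it forces \<open>a_6 = a_4\<close>; comparing the two equations for their common derivative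
  eliminates \<open>a_1\<close>, so that \<open>a_4 - \<beta> h\<close> is constant.  Being odd under the half turn,
  that constant is zero.\<close>

lemma radial_coefficients:
  fixes a a' :: "nat \<Rightarrow> real \<Rightarrow> real" and \<beta> :: real
  defines "b \<equiv> \<lambda>k::nat. if k = 1 then \<beta> else 0"
  assumes d: "\<And>k \<theta>. (a k has_real_derivative a' k \<theta>) (at \<theta>)"
    and fin: "\<And>k \<theta>. k > n \<Longrightarrow> a k \<theta> = 0"
    and rec: "\<And>k \<theta>. a' (k + 5) \<theta> + h \<theta> * ((real k - 2) * a (k + 2) \<theta> + (real k - 6) * a k \<theta>)
                = h' \<theta> * (b (k + 2) + b k)"
    and rec3: "\<And>\<theta>. a' 3 \<theta> - 4 * h \<theta> * a 0 \<theta> = h' \<theta> * b 0"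
    and rec4: "\<And>\<theta>. a' 4 \<theta> - 3 * h \<theta> * a 1 \<theta> = h' \<theta> * b 1"
    and parity: "\<And>\<theta>. a 4 (\<theta> + pi) = - a 4 \<theta>"
  shows "a k \<theta> = (if k = 4 \<or> k = 6 then \<beta> * h \<theta> else 0)"
proof -
  have a'0: "a' k \<theta> = 0" if "\<And>\<theta>. a k \<theta> = 0" for k \<theta>
  proof -
    have "a k = (\<lambda>_. 0)" using that by auto
    then show ?thesis using d[of k \<theta>] DERIV_unique[OF _ DERIV_const] by metis
  qed
  have hi: "a k \<theta> = 0" if "k \<ge> 7" for k \<theta>
  proof (rule zero_above[OF fin _ that])
    fix k \<theta> assume k: "k \<ge> (7::nat)" and z: "\<And>j \<theta>. j > k \<Longrightarrow> a j \<theta> = 0"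
    have "h \<theta> * a k \<theta> = 0" for \<theta>
      using rec[of k \<theta>] k by (simp add: z a'0 b_def)
    then show "a k \<theta> = 0" by (rule h_mult_zero[OF d])
  qed
  have a5: "a 5 \<theta> = 0" for \<theta>
    using rec[of 5] by (intro h_mult_zero[OF d]) (simp add: a'0 hi b_def)
  have a3: "a 3 \<theta> = 0" for \<theta>
    using rec[of 3] by (intro h_mult_zero[OF d]) (simp add: a'0 hi a5 b_def)
  have a2: "a 2 \<theta> = 0" for \<theta>
    using rec[of 2] by (intro h_mult_zero[OF d]) (simp add: a'0 hi b_def)
  have a0: "a 0 \<theta> = 0" for \<theta>
    using rec3 by (intro h_mult_zero[OF d]) (simp add: a'0 a3 b_def)
  have a64: "a 6 \<theta> = a 4 \<theta>" for \<theta>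
  proof -
    have "((\<lambda>\<theta>. a 6 \<theta> - a 4 \<theta>) has_real_derivative a' 6 \<theta> - a' 4 \<theta>) (at \<theta>)" for \<theta>
      by (intro DERIV_diff d)
    moreover have "h \<theta> * (a 6 \<theta> - a 4 \<theta>) = 0" for \<theta>
      using rec[of 4 \<theta>] by (simp add: a'0 hi b_def algebra_simps)
    ultimately show ?thesis using h_mult_zero[of "\<lambda>\<theta>. a 6 \<theta> - a 4 \<theta>" "\<lambda>\<theta>. a' 6 \<theta> - a' 4 \<theta>" \<theta>] by simp
  qed
  then have "a 6 = a 4" by auto
  then have a'64: "a' 6 \<theta> = a' 4 \<theta>" for \<theta> using d[of 6 \<theta>] d[of 4 \<theta>] by (metis DERIV_unique)
  have a1: "a 1 \<theta> = 0" for \<theta>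
  proof (rule h_mult_zero[OF d])
    fix \<theta>
    show "h \<theta> * a 1 \<theta> = 0"
      using rec[of 1 \<theta>] rec4[of \<theta>] a3[of \<theta>] a'64[of \<theta>]
      by (simp add: b_def eval_nat_numeral algebra_simps)
  qed
  have "((\<lambda>\<theta>. a 4 \<theta> - \<beta> * h \<theta>) has_real_derivative 0) (at \<theta>)" for \<theta>
    using DERIV_diff[OF d[of 4 \<theta>] DERIV_cmult[OF h_deriv, of \<beta>]] rec4[of \<theta>] a1[of \<theta>]
    by (simp add: b_def algebra_simps)
  then have const: "a 4 x - \<beta> * h x = a 4 y - \<beta> * h y" for x y
    using DERIV_isconst_all[of "\<lambda>\<theta>. a 4 \<theta> - \<beta> * h \<theta>"] by blast
  have a4: "a 4 \<theta> = \<beta> * h \<theta>" for \<theta>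
    using const[of "\<theta> + pi" \<theta>] unfolding parity h_shift_pi by simp
  consider "k = 0" | "k = 1" | "k = 2" | "k = 3" | "k = 4" | "k = 5" | "k = 6" | "k \<ge> 7" by linarith
  then show ?thesis
    by cases (simp_all add: a0 a1[unfolded One_nat_def] a2 a3 a4 a5 a64 hi)
qed

lemma er_et_eq_iff:
  "a *\<^sub>R er \<theta> + b *\<^sub>R et \<theta> = c *\<^sub>R er \<theta> + d *\<^sub>R et \<theta> \<longleftrightarrow> a = c \<and> b = d"
proof
  assume eq: "a *\<^sub>R er \<theta> + b *\<^sub>R et \<theta> = c *\<^sub>R er \<theta> + d *\<^sub>R et \<theta>"
  have i: "er \<theta> \<bullet> er \<theta> = 1" "et \<theta> \<bullet> et \<theta> = 1" "er \<theta> \<bullet> et \<theta> = 0" "et \<theta> \<bullet> er \<theta> = 0"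
    using sin_cos_squared_add[of \<theta>] by (auto simp: er_def et_def power2_eq_square)
  show "a = c \<and> b = d"
    using arg_cong[OF eq, of "\<lambda>v. v \<bullet> er \<theta>"] arg_cong[OF eq, of "\<lambda>v. v \<bullet> et \<theta>"]
    by (simp add: inner_add_left i)
qed auto

text \<open>The derivative of a field in the radial and angular directions is obtained by
  differentiating its polar form along a ray and along a circle.  The frame is constant on rays,
  while on circles its rotation contributes the terms without derivatives.\<close>

lemma frechet_derivative_polar:
  fixes Y :: "plane \<Rightarrow> plane"
  assumes Y: "Y differentiable (at (r *\<^sub>R er \<theta>))"
    and polar: "\<And>r \<theta>. Y (r *\<^sub>R er \<theta>) = f r \<theta> *\<^sub>R er \<theta> + g r \<theta> *\<^sub>R et \<theta>"
    and fr: "((\<lambda>r. f r \<theta>) has_real_derivative fr) (at r)"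
    and gr: "((\<lambda>r. g r \<theta>) has_real_derivative gr) (at r)"
    and ft: "((\<lambda>\<theta>. f r \<theta>) has_real_derivative ft) (at \<theta>)"
    and gt: "((\<lambda>\<theta>. g r \<theta>) has_real_derivative gt) (at \<theta>)"
  shows "frechet_derivative Y (at (r *\<^sub>R er \<theta>)) (er \<theta>) = fr *\<^sub>R er \<theta> + gr *\<^sub>R et \<theta>"
    and "frechet_derivative Y (at (r *\<^sub>R er \<theta>)) (r *\<^sub>R et \<theta>) =
           (ft - g r \<theta>) *\<^sub>R er \<theta> + (gt + f r \<theta>) *\<^sub>R et \<theta>"
proof -
  let ?D = "frechet_derivative Y (at (r *\<^sub>R er \<theta>))"
  have D: "(Y has_derivative ?D) (at (r *\<^sub>R er \<theta>) within S)" for S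
    using Y frechet_derivative_works has_derivative_at_withinI by blast
  have "((\<lambda>s. s *\<^sub>R er \<theta>) has_vector_derivative er \<theta>) (at r)"
    by (auto intro!: derivative_eq_intros)
  from vector_derivative_diff_chain_within[OF this D]
  have "((\<lambda>s. f s \<theta> *\<^sub>R er \<theta> + g s \<theta> *\<^sub>R et \<theta>) has_vector_derivative ?D (er \<theta>)) (at r)"
    by (simp add: o_def polar)
  moreover have "((\<lambda>s. f s \<theta> *\<^sub>R er \<theta> + g s \<theta> *\<^sub>R et \<theta>) has_vector_derivative
      fr *\<^sub>R er \<theta> + gr *\<^sub>R et \<theta>) (at r)"
    using has_vector_derivative_add[OF
        has_vector_derivative_scaleR[OF fr has_vector_derivative_const]
        has_vector_derivative_scaleR[OF gr has_vector_derivative_const]] by simp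
  ultimately show "?D (er \<theta>) = fr *\<^sub>R er \<theta> + gr *\<^sub>R et \<theta>"
    by (rule vector_derivative_unique_at)
  have "((\<lambda>t. r *\<^sub>R er t) has_vector_derivative r *\<^sub>R et \<theta>) (at \<theta>)"
    by (rule bounded_linear.has_vector_derivative[OF bounded_linear_scaleR_right er_deriv])
  from vector_derivative_diff_chain_within[OF this D]
  have "((\<lambda>t. f r t *\<^sub>R er t + g r t *\<^sub>R et t) has_vector_derivative ?D (r *\<^sub>R et \<theta>)) (at \<theta>)"
    by (simp add: o_def polar)
  moreover have "((\<lambda>t. f r t *\<^sub>R er t + g r t *\<^sub>R et t) has_vector_derivative
      (ft - g r \<theta>) *\<^sub>R er \<theta> + (gt + f r \<theta>) *\<^sub>R et \<theta>) (at \<theta>)"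
    using has_vector_derivative_add[OF has_vector_derivative_scaleR[OF ft er_deriv]
        has_vector_derivative_scaleR[OF gt et_deriv]] by (simp add: algebra_simps)
  ultimately show "?D (r *\<^sub>R et \<theta>) = (ft - g r \<theta>) *\<^sub>R er \<theta> + (gt + f r \<theta>) *\<^sub>R et \<theta>"
    by (rule vector_derivative_unique_at)
qed

lemma example_field_differentiable: "example_field differentiable (at p)"
  unfolding differentiable_def example_field_def split_def
  by (intro exI) (rule derivative_eq_intros refl | simp)+

text \<open>The bracket condition in the rotating frame, in which the field itself has the components
  \<open>(r^4 + r^6) h\<close> and \<open>r\<close>.  Away from the origin the angular direction can be normalised by
  dividing by \<open>r\<close>.\<close>

lemma commuting_polar:
  assumes Y: "Y differentiable (at (r *\<^sub>R er \<theta>))" and comm: "commuting example_field Y"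
    and r: "r \<noteq> 0"
    and polar: "\<And>r \<theta>. Y (r *\<^sub>R er \<theta>) = f r \<theta> *\<^sub>R er \<theta> + g r \<theta> *\<^sub>R et \<theta>"
    and fr: "((\<lambda>r. f r \<theta>) has_real_derivative fr) (at r)"
    and gr: "((\<lambda>r. g r \<theta>) has_real_derivative gr) (at r)"
    and ft: "((\<lambda>\<theta>. f r \<theta>) has_real_derivative ft) (at \<theta>)"
    and gt: "((\<lambda>\<theta>. g r \<theta>) has_real_derivative gt) (at \<theta>)"
  shows "ft + h \<theta> * ((r^4 + r^6) * fr) =
           h \<theta> * ((4 * r^3 + 6 * r^5) * f r \<theta>) + h' \<theta> * ((r^3 + r^5) * g r \<theta>)"
    and "gt + h \<theta> * ((r^4 + r^6) * gr) = h \<theta> * ((r^3 + r^5) * g r \<theta>)"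
proof -
  let ?p = "r *\<^sub>R er \<theta>"
  let ?DY = "frechet_derivative Y (at ?p)" and ?DX = "frechet_derivative example_field (at ?p)"
  note DY = frechet_derivative_polar[OF Y polar fr gr ft gt]
  have X: "example_field (r *\<^sub>R er \<theta>) = ((r^4 + r^6) * h \<theta>) *\<^sub>R er \<theta> + r *\<^sub>R et \<theta>" for r \<theta>
    by (simp add: example_field_polar)
  have "((\<lambda>r. (r^4 + r^6) * h \<theta>) has_real_derivative (4 * r^3 + 6 * r^5) * h \<theta>) (at r)"
    "((\<lambda>r. r) has_real_derivative 1) (at r)"
    "((\<lambda>\<theta>. (r^4 + r^6) * h \<theta>) has_real_derivative (r^4 + r^6) * h' \<theta>) (at \<theta>)"
    "((\<lambda>\<theta>. r) has_real_derivative 0) (at \<theta>)"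
    by (auto intro!: derivative_eq_intros DERIV_cmult h_deriv)
  note DX = frechet_derivative_polar[OF example_field_differentiable X this]
  have lin: "linear ?DY" "linear ?DX"
    by (rule linear_frechet_derivative, fact Y, rule linear_frechet_derivative, rule example_field_differentiable)
  have "?DY (example_field ?p) = ((r^4 + r^6) * h \<theta>) *\<^sub>R ?DY (er \<theta>) + ?DY (r *\<^sub>R et \<theta>)"
    unfolding X using lin(1) by (simp add: linear_add linear_cmul)
  also have "\<dots> = (ft - g r \<theta> + (r^4 + r^6) * h \<theta> * fr) *\<^sub>R er \<theta>
        + (gt + f r \<theta> + (r^4 + r^6) * h \<theta> * gr) *\<^sub>R et \<theta>"
    unfolding DY by (simp add: algebra_simps)
  finally have l: "?DY (example_field ?p) = \<dots>" .
  have "Y ?p = f r \<theta> *\<^sub>R er \<theta> + (g r \<theta> / r) *\<^sub>R (r *\<^sub>R et \<theta>)" using r by (simp add: polar)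
  then have "?DX (Y ?p) = f r \<theta> *\<^sub>R ?DX (er \<theta>) + (g r \<theta> / r) *\<^sub>R ?DX (r *\<^sub>R et \<theta>)"
    using lin(2) by (simp only: linear_add linear_cmul)
  also have "\<dots> = (f r \<theta> * ((4 * r^3 + 6 * r^5) * h \<theta>) + g r \<theta> / r * ((r^4 + r^6) * h' \<theta> - r)) *\<^sub>R er \<theta>
        + (f r \<theta> + g r \<theta> / r * ((r^4 + r^6) * h \<theta>)) *\<^sub>R et \<theta>"
    unfolding DX by (simp add: algebra_simps)
  finally have m: "?DX (Y ?p) = \<dots>" .
  have "?DY (example_field ?p) = ?DX (Y ?p)"
    using comm unfolding commuting_def lie_bracket_def by (metis eq_iff_diff_eq_0)
  then have
    "ft - g r \<theta> + (r^4 + r^6) * h \<theta> * fr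
      = f r \<theta> * ((4 * r^3 + 6 * r^5) * h \<theta>) + g r \<theta> / r * ((r^4 + r^6) * h' \<theta> - r)"
    "gt + f r \<theta> + (r^4 + r^6) * h \<theta> * gr = f r \<theta> + g r \<theta> / r * ((r^4 + r^6) * h \<theta>)"
    unfolding l m er_et_eq_iff by auto
  moreover have "g r \<theta> / r * ((r^4 + r^6) * h' \<theta> - r) = h' \<theta> * ((r^3 + r^5) * g r \<theta>) - g r \<theta>"
    "g r \<theta> / r * ((r^4 + r^6) * h \<theta>) = h \<theta> * ((r^3 + r^5) * g r \<theta>)"
    using r by (simp_all add: field_simps eval_nat_numeral)
  ultimately show "ft + h \<theta> * ((r^4 + r^6) * fr) =
           h \<theta> * ((4 * r^3 + 6 * r^5) * f r \<theta>) + h' \<theta> * ((r^3 + r^5) * g r \<theta>)"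
    "gt + h \<theta> * ((r^4 + r^6) * gr) = h \<theta> * ((r^3 + r^5) * g r \<theta>)"
    by (simp_all add: algebra_simps)
qed

lemma poly_eq_off_zero:
  fixes p q :: "real poly"
  assumes "\<And>r. r \<noteq> 0 \<Longrightarrow> poly p r = poly q r"
  shows "p = q"
proof -
  have "poly (monom 1 1 * p) r = poly (monom 1 1 * q) r" for r
    using assms[of r] by (cases "r = 0") (auto simp: poly_monom)
  then have "monom 1 1 * p = monom 1 1 * q" by (metis poly_eq_poly_eq_iff ext)
  then show ?thesis by simp
qed

lemma polynomial_function_polar:
  fixes Y :: "plane \<Rightarrow> plane"
  assumes "polynomial_function Y"
  obtains F F' K K' where "poly_family F F'" "poly_family K K'"
    "\<And>r \<theta>. Y (r *\<^sub>R er \<theta>) = poly (F \<theta>) r *\<^sub>R er \<theta> + poly (K \<theta>) r *\<^sub>R et \<theta>"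
proof -
  have "real_polynomial_function (fst \<circ> Y)" "real_polynomial_function (snd \<circ> Y)"
    using assms bounded_linear_fst bounded_linear_snd unfolding polynomial_function_def by blast+
  from this[THEN real_polynomial_function_polar]
  obtain p p' q q' where p: "poly_family p p'" "\<And>r \<theta>. fst (Y (r *\<^sub>R er \<theta>)) = poly (p \<theta>) r"
    and q: "poly_family q q'" "\<And>r \<theta>. snd (Y (r *\<^sub>R er \<theta>)) = poly (q \<theta>) r"
    unfolding comp_apply by blast
  have c: "poly_family (\<lambda>\<theta>. [:cos \<theta>:]) (\<lambda>\<theta>. [:- sin \<theta>:])"
    and s: "poly_family (\<lambda>\<theta>. [:sin \<theta>:]) (\<lambda>\<theta>. [:cos \<theta>:])"
    and ms: "poly_family (\<lambda>\<theta>. [:- sin \<theta>:]) (\<lambda>\<theta>. [:- cos \<theta>:])"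
    by (auto intro!: poly_family_const derivative_eq_intros)
  have "Y (r *\<^sub>R er \<theta>) = poly ([:cos \<theta>:] * p \<theta> + [:sin \<theta>:] * q \<theta>) r *\<^sub>R er \<theta>
      + poly ([:- sin \<theta>:] * p \<theta> + [:cos \<theta>:] * q \<theta>) r *\<^sub>R et \<theta>" for r \<theta>
  proof (rule prod_eqI)
    let ?a = "poly (p \<theta>) r" and ?b = "poly (q \<theta>) r"
    have "(cos \<theta> * ?a + sin \<theta> * ?b) * cos \<theta> + (cos \<theta> * ?b - sin \<theta> * ?a) * - sin \<theta>
        = (sin \<theta>^2 + cos \<theta>^2) * ?a"
      "(cos \<theta> * ?a + sin \<theta> * ?b) * sin \<theta> + (cos \<theta> * ?b - sin \<theta> * ?a) * cos \<theta>
        = (sin \<theta>^2 + cos \<theta>^2) * ?b"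
      by algebra+
    then show "fst (Y (r *\<^sub>R er \<theta>)) = fst (poly ([:cos \<theta>:] * p \<theta> + [:sin \<theta>:] * q \<theta>) r *\<^sub>R er \<theta>
      + poly ([:- sin \<theta>:] * p \<theta> + [:cos \<theta>:] * q \<theta>) r *\<^sub>R et \<theta>)"
      "snd (Y (r *\<^sub>R er \<theta>)) = snd (poly ([:cos \<theta>:] * p \<theta> + [:sin \<theta>:] * q \<theta>) r *\<^sub>R er \<theta>
      + poly ([:- sin \<theta>:] * p \<theta> + [:cos \<theta>:] * q \<theta>) r *\<^sub>R et \<theta>)"
      unfolding p q by (simp_all add: er_def et_def)
  qed
  then show ?thesis
    by (rule that[OF poly_family_add[OF poly_family_mult[OF c p(1)] poly_family_mult[OF s q(1)]]
        poly_family_add[OF poly_family_mult[OF ms p(1)] poly_family_mult[OF c q(1)]]])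
qed

text \<open>The two partial differential equations become polynomial identities in \<open>r\<close> for each
  angle, and their coefficients are the recurrences solved above.\<close>

lemma commuting_proportional:
  assumes poly: "polynomial_function Y" and comm: "commuting example_field Y"
  shows "proportional_to example_field Y"
proof -
  obtain F F' K K' where F: "poly_family F F'" and K: "poly_family K K'" and
    polar: "\<And>r \<theta>. Y (r *\<^sub>R er \<theta>) = poly (F \<theta>) r *\<^sub>R er \<theta> + poly (K \<theta>) r *\<^sub>R et \<theta>"
    using polynomial_function_polar[OF poly] by blast
  have dF: "((\<lambda>\<theta>. coeff (F \<theta>) k) has_real_derivative coeff (F' \<theta>) k) (at \<theta>)"
    and dK: "((\<lambda>\<theta>. coeff (K \<theta>) k) has_real_derivative coeff (K' \<theta>) k) (at \<theta>)" for k \<theta>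
    using F K unfolding poly_family_def by auto
  obtain nF nK where "\<And>\<theta>. degree (F \<theta>) \<le> nF" "\<And>\<theta>. degree (K \<theta>) \<le> nK"
    using F K unfolding poly_family_def by blast
  then have finF: "\<And>k \<theta>. k > nF \<Longrightarrow> coeff (F \<theta>) k = 0"
    and finK: "\<And>k \<theta>. k > nK \<Longrightarrow> coeff (K \<theta>) k = 0"
    by (meson coeff_eq_0 le_less_trans)+
  have Y: "Y differentiable (at p)" for p using poly by (rule differentiable_at_polynomial_function)
  note pde = commuting_polar[OF Y comm _ polar poly_DERIV poly_DERIV
      poly_family_deriv[OF F] poly_family_deriv[OF K]]
  have eqF: "F' \<theta> + smult (h \<theta>) (monom 1 4 * pderiv (F \<theta>) + monom 1 6 * pderiv (F \<theta>)) =
      smult (h \<theta>) (monom 4 3 * F \<theta> + monom 6 5 * F \<theta>) + smult (h' \<theta>) (monom 1 3 * K \<theta> + monom 1 5 * K \<theta>)" for \<theta>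
    using pde(1)[of _ \<theta>] by (intro poly_eq_off_zero) (simp add: poly_monom algebra_simps)
  have eqK: "K' \<theta> + smult (h \<theta>) (monom 1 4 * pderiv (K \<theta>) + monom 1 6 * pderiv (K \<theta>)) =
      smult (h \<theta>) (monom 1 3 * K \<theta> + monom 1 5 * K \<theta>)" for \<theta>
    using pde(2)[of _ \<theta>] by (intro poly_eq_off_zero) (simp add: poly_monom algebra_simps)
  have coeffF: "coeff (F' \<theta>) n + h \<theta> * ((if n < 4 then 0 else real (Suc (n - 4)) * coeff (F \<theta>) (Suc (n - 4)))
        + (if n < 6 then 0 else real (Suc (n - 6)) * coeff (F \<theta>) (Suc (n - 6))))
    = h \<theta> * ((if n < 3 then 0 else 4 * coeff (F \<theta>) (n - 3))
        + (if n < 5 then 0 else 6 * coeff (F \<theta>) (n - 5)))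
      + h' \<theta> * ((if n < 3 then 0 else coeff (K \<theta>) (n - 3))
        + (if n < 5 then 0 else coeff (K \<theta>) (n - 5)))" for n \<theta>
    using arg_cong[OF eqF, of "\<lambda>p. coeff p n" \<theta>]
    unfolding coeff_add coeff_smult coeff_monom_mult coeff_pderiv mult_1 .
  have coeffK: "coeff (K' \<theta>) n + h \<theta> * ((if n < 4 then 0 else real (Suc (n - 4)) * coeff (K \<theta>) (Suc (n - 4)))
        + (if n < 6 then 0 else real (Suc (n - 6)) * coeff (K \<theta>) (Suc (n - 6))))
    = h \<theta> * ((if n < 3 then 0 else coeff (K \<theta>) (n - 3))
        + (if n < 5 then 0 else coeff (K \<theta>) (n - 5)))" for n \<theta>
    using arg_cong[OF eqK, of "\<lambda>p. coeff p n" \<theta>]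
    unfolding coeff_add coeff_smult coeff_monom_mult coeff_pderiv mult_1 .
  have "\<exists>\<beta>. \<forall>k \<theta>. coeff (K \<theta>) k = (if k = 1 then \<beta> else 0)"
  proof (rule tangential_coefficients[OF dK finK])
    fix k \<theta>
    show "coeff (K' \<theta>) (k + 5) + h \<theta> * ((real k + 1) * coeff (K \<theta>) (k + 2) + (real k - 1) * coeff (K \<theta>) k) = 0"
      using coeffK[of \<theta> "k + 5"] by (cases k) (simp_all add: eval_nat_numeral algebra_simps)
  next
    fix \<theta>
    show "coeff (K' \<theta>) 3 - h \<theta> * coeff (K \<theta>) 0 = 0"
      using coeffK[of \<theta> "3"] by (simp add: eval_nat_numeral algebra_simps)
    show "coeff (K' \<theta>) 1 = 0"
      using coeffK[of \<theta> "1"] by (simp add: eval_nat_numeral algebra_simps)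
  qed
  then obtain \<beta> where \<beta>: "\<And>k \<theta>. coeff (K \<theta>) k = (if k = 1 then \<beta> else 0)" by blast
  \<comment> \<open>The points with polar coordinates \<open>(r, \<theta> + \<pi>)\<close> and \<open>(- r, \<theta>)\<close> agree, but the frame
    vectors there are opposite.\<close>
  have "F (\<theta> + pi) = - pcompose (F \<theta>) [:0, -1:]" for \<theta>
  proof (rule poly_eq_off_zero)
    fix r
    have "er (\<theta> + pi) = - er \<theta>" "et (\<theta> + pi) = - et \<theta>" by (auto simp: er_def et_def)
    then have "poly (- F (\<theta> + pi)) r *\<^sub>R er \<theta> + poly (- K (\<theta> + pi)) r *\<^sub>R et \<theta> =
       poly (F \<theta>) (- r) *\<^sub>R er \<theta> + poly (K \<theta>) (- r) *\<^sub>R et \<theta>"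
      using polar[of r "\<theta> + pi"] polar[of "- r" \<theta>] by simp
    then show "poly (F (\<theta> + pi)) r = poly (- pcompose (F \<theta>) [:0, -1:]) r"
      unfolding er_et_eq_iff by (simp add: poly_pcompose)
  qed
  then have parity: "coeff (F (\<theta> + pi)) 4 = - coeff (F \<theta>) 4" for \<theta>
    by (simp add: coeff_pcompose_linear)
  have \<alpha>: "coeff (F \<theta>) k = (if k = 4 \<or> k = 6 then \<beta> * h \<theta> else 0)" for k \<theta>
  proof (rule radial_coefficients[where a = "\<lambda>k \<theta>. coeff (F \<theta>) k"
        and a' = "\<lambda>k \<theta>. coeff (F' \<theta>) k" and \<beta> = \<beta>, OF dF finF _ _ _ parity])
    fix k \<theta>
    show "coeff (F' \<theta>) (k + 5) + h \<theta> * ((real k - 2) * coeff (F \<theta>) (k + 2) + (real k - 6) * coeff (F \<theta>) k)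
       = h' \<theta> * ((if k + 2 = 1 then \<beta> else 0) + (if k = 1 then \<beta> else 0))"
      using coeffF[of \<theta> "k + 5"] unfolding \<beta>[symmetric, of _ \<theta>]
      by (cases k) (simp_all add: eval_nat_numeral algebra_simps)
  next
    fix \<theta>
    show "coeff (F' \<theta>) 3 - 4 * h \<theta> * coeff (F \<theta>) 0 = h' \<theta> * (if 0 = (1::nat) then \<beta> else 0)"
      using coeffF[of \<theta> "3"] by (simp add: eval_nat_numeral algebra_simps \<beta>)
    show "coeff (F' \<theta>) 4 - 3 * h \<theta> * coeff (F \<theta>) 1 = h' \<theta> * (if 1 = (1::nat) then \<beta> else 0)"
      using coeffF[of \<theta> "4"] by (simp add: eval_nat_numeral algebra_simps \<beta>)
  qed
  have "K \<theta> = monom \<beta> 1" "F \<theta> = monom (\<beta> * h \<theta>) 4 + monom (\<beta> * h \<theta>) 6" for \<theta>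
    by (auto intro!: poly_eqI simp: \<beta> \<alpha>)
  then have "Y (r *\<^sub>R er \<theta>) = \<beta> *\<^sub>R example_field (r *\<^sub>R er \<theta>)" for r \<theta>
    unfolding polar example_field_polar by (simp add: poly_monom algebra_simps)
  then have "Y p = \<beta> *\<^sub>R example_field p" for p using polar_point[of p] by metis
  then show ?thesis unfolding proportional_to_def by blast
qed

theorem mainTheorem3:
  shows "uniformly_isochronous example_field \<and>
         is_center example_field (0, 0) \<and>
         \<not> reversible example_field \<and>
         (\<forall>Y. polynomial_function Y \<and> commuting example_field Y
                \<longrightarrow> proportional_to example_field Y) \<and>
         \<not> (\<forall>X. uniformly_isochronous X \<and> is_center X (0, 0) \<longrightarrow>
                reversible X \<or>
                (\<exists>Y. polynomial_function Y \<and> commuting X Y \<and> \<not> proportional_to X Y))"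
  using isochronous center not_reversible commuting_proportional by blast

end
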